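(* Let $T$ be a tree with $\mu(T)=m$. Then the value of the star-game on $T$ with Minimizer responding (and Maximizer initiating) is at least $\lceil m/2\rceil$. Moreover this bound is sharp: for every positive integer $m$ there is a tree $T$ with $\mu(T)=m$ for which the value of the star-game with Minimizer responding equals $\lceil m/2\rceil$.
   Context: Graphs are finite, simple and undirected. $P_3$ is the path on three vertices; copies of $P_3$ in a graph are subgraphs, not necessarily induced. A $P_3$-packing of $G$ is a collection of vertex-disjoint copies of $P_3$ in $G$, and $\mu(G)$ is the maximum size (number of copies) of a $P_3$-packing of $G$. The star-game on a graph $G$ is played by two players, Maximizer and Minimizer; throughout the game one of them is the initiator and the other is the responder. In each round, the initiator chooses a vertex $v$ of the current graph such that the current graph contains at least one copy of $P_3$ with $v$ as its center vertex (degree-2 vertex of the path); the responder then chooses one copy of $P_3$ in the current graph with $v$ as its center; the three vertices of that copy are removed, and the next round is played on the subgraph induced by the remaining vertices. The game ends when the remaining graph contains no copy of $P_3$. Maximizer tries to maximize, and Minimizer tries to minimize, the number of copies of $P_3$ taken. The value of the game is the number of copies taken under optimal play by both players. *)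

theory Defs
  imports Complex_Main "Graph_Theory.Graph_Theory"
begin

text \<open>
  Finite simple undirected graphs are the digraphs satisfying the locale predicate
  \<^const>\<open>graph\<close> (finite, loop-free, no parallel arcs, symmetric): an edge is a pair of
  opposite arcs.  In this encoding every edge is a directed cycle of length 2, so the library
  constant \<^const>\<open>tree\<close>, which forbids all directed cycles, does not describe undirected trees.
  The cycles of the undirected graph are exactly the directed cycles of length at least 3.
\<close>

definition undirected_tree :: "('a, 'b) pre_digraph \<Rightarrow> bool" where
  "undirected_tree G \<longleftrightarrow> graph G \<and> Digraph_Component.connected G \<and>
     \<not> (\<exists>p. pre_digraph.cycle G p \<and> 3 \<le> length p)"

text \<open>
  A copy of the three-vertex path with centre \<open>v\<close> and ends \<open>u\<close>, \<open>w\<close> is given by the triple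
  \<open>(u, v, w)\<close>.  The reversed triple stands for the same copy; this affects neither the size of
  a packing, whose members are disjoint, nor the positions reachable in the game.
\<close>

definition P3_copies :: "('a, 'b) pre_digraph \<Rightarrow> ('a \<times> 'a \<times> 'a) set" where
  "P3_copies G = {(u, v, w). {u, v, w} \<subseteq> verts G \<and> u \<noteq> w \<and> u \<noteq> v \<and> v \<noteq> w \<and>
     u \<rightarrow>\<^bsub>G\<^esub> v \<and> v \<rightarrow>\<^bsub>G\<^esub> w}"

fun P3_verts :: "'a \<times> 'a \<times> 'a \<Rightarrow> 'a set" where
  "P3_verts (u, v, w) = {u, v, w}"

fun P3_centre :: "'a \<times> 'a \<times> 'a \<Rightarrow> 'a" where
  "P3_centre (u, v, w) = v"

definition P3_packing :: "('a, 'b) pre_digraph \<Rightarrow> ('a \<times> 'a \<times> 'a) set \<Rightarrow> bool" where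
  "P3_packing G P \<longleftrightarrow> P \<subseteq> P3_copies G \<and>
     (\<forall>p\<in>P. \<forall>q\<in>P. p \<noteq> q \<longrightarrow> P3_verts p \<inter> P3_verts q = {})"

definition P3_packing_number :: "('a, 'b) pre_digraph \<Rightarrow> nat" where
  "P3_packing_number G = Max (card ` {P. P3_packing G P})"

definition copies_centred_at :: "('a, 'b) pre_digraph \<Rightarrow> 'a \<Rightarrow> ('a \<times> 'a \<times> 'a) set" where
  "copies_centred_at G v = {p \<in> P3_copies G. P3_centre p = v}"

definition remove_copy :: "('a, 'b) pre_digraph \<Rightarrow> 'a \<times> 'a \<times> 'a \<Rightarrow> ('a, 'b) pre_digraph" where
  "remove_copy G p = G \<restriction> (verts G - P3_verts p)"

lemma card_verts_remove_copy:
  assumes "finite (verts G)" "p \<in> P3_copies G"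
  shows "card (verts (remove_copy G p)) < card (verts G)"
proof -
  have "verts (remove_copy G p) \<subset> verts G"
    using assms(2) by (auto simp: remove_copy_def P3_copies_def)
  then show ?thesis
    by (rule psubset_card_mono[OF assms(1)])
qed

text \<open>
  Backward-induction value of the star-game in which Maximizer initiates and Minimizer
  responds.  The finiteness guard only serves termination.
\<close>

function star_game_value_min_responding :: "('a, 'b) pre_digraph \<Rightarrow> nat" where
  "star_game_value_min_responding G =
     (if finite (verts G) \<and> P3_copies G \<noteq> {} then
        Max ((\<lambda>v. Min ((\<lambda>p. Suc (star_game_value_min_responding (remove_copy G p)))
                       ` copies_centred_at G v))
             ` {v \<in> verts G. copies_centred_at G v \<noteq> {}})
      else 0)"
  by pat_completeness auto
termination
  by (relation "measure (\<lambda>G. card (verts G))")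
    (auto simp: copies_centred_at_def intro: card_verts_remove_copy)

declare star_game_value_min_responding.simps [simp del]

end

theory Submission
  imports Defs
begin

text \<open>
  Both halves rest on what a single round can destroy.

  For the lower bound, call a vertex \<open>v\<close> of a forest peripheral if all of its neighbours, with at
  most one exception, are leaves.  Whatever copy with centre \<open>v\<close> Minimizer takes, it contains a
  leaf attached to \<open>v\<close>, the vertex \<open>v\<close>, and one further vertex.  A copy of the path that contains
  the leaf contains \<open>v\<close> too, so the members of a packing that meet the removed copy all pass through
  \<open>v\<close> or through the third vertex: there are at most two of them.  Hence a round started at a
  peripheral vertex lowers the packing number by at most 2, and Maximizer needs only such
  rounds, because the second vertex of a longest path is peripheral
  (\<open>forest_has_peripheral_centre\<close>, \<open>forest_packing_number_le\<close>).

  For sharpness, take a path on \<open>m\<close> vertices and attach two leaves to each of them.  The \<open>m\<close> stars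
  thus obtained form a perfect packing.  Group the path vertices into consecutive pairs, the last
  one being alone if \<open>m\<close> is odd.  Only path vertices can be centres.  When Maximizer names one,
  Minimizer removes it together with a leaf and with its partner, or with both leaves if
  the partner is missing.  Every round thus uses up one of the \<open>\<lceil>m/2\<rceil>\<close> pairs, and each
  surviving path vertex keeps its two leaves, so that the strategy can be repeated.
\<close>

section \<open>Packings\<close>

lemma P3_verts_subset: "p \<in> P3_copies G \<Longrightarrow> P3_verts p \<subseteq> verts G"
  by (auto simp: P3_copies_def)

lemma finite_P3_copies:
  assumes "finite (verts G)"
  shows "finite (P3_copies G)"
proof -
  have "P3_copies G \<subseteq> verts G \<times> verts G \<times> verts G"
    by (auto simp: P3_copies_def)
  then show ?thesis
    using assms by (meson finite_SigmaI finite_subset)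
qed

lemma finite_P3_packings:
  assumes "finite (verts G)"
  shows "finite {P. P3_packing G P}"
proof -
  have "{P. P3_packing G P} \<subseteq> Pow (P3_copies G)"
    by (auto simp: P3_packing_def)
  then show ?thesis
    using finite_P3_copies[OF assms] by (meson finite_Pow_iff finite_subset)
qed

lemma finite_P3_packing:
  "finite (verts G) \<Longrightarrow> P3_packing G P \<Longrightarrow> finite P"
  unfolding P3_packing_def using finite_P3_copies finite_subset by blast

lemma card_le_packing_number:
  "finite (verts G) \<Longrightarrow> P3_packing G P \<Longrightarrow> card P \<le> P3_packing_number G"
  unfolding P3_packing_number_def using finite_P3_packings by (auto intro!: Max_ge)

lemma maximum_packing_exists:
  assumes "finite (verts G)"
  obtains P where "P3_packing G P" "card P = P3_packing_number G"
proof -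
  have "P3_packing G {}"
    by (simp add: P3_packing_def)
  then have "Max (card ` {P. P3_packing G P}) \<in> card ` {P. P3_packing G P}"
    using finite_P3_packings[OF assms] by (intro Max_in) auto
  then show ?thesis
    using that by (auto simp: P3_packing_number_def)
qed

lemma card_packing_members_at_le_1:
  assumes "P3_packing G P"
  shows "card {q \<in> P. x \<in> P3_verts q} \<le> 1"
proof -
  have "q1 = q2" if "q1 \<in> {q \<in> P. x \<in> P3_verts q}" "q2 \<in> {q \<in> P. x \<in> P3_verts q}" for q1 q2
    using assms that unfolding P3_packing_def by blast
  then obtain q where "{q \<in> P. x \<in> P3_verts q} \<subseteq> {q}"
    by blast
  then have "card {q \<in> P. x \<in> P3_verts q} \<le> card {q}"
    by (intro card_mono) auto
  then show ?thesis
    by simp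
qed

lemma verts_remove_copy [simp]: "verts (remove_copy G p) = verts G - P3_verts p"
  by (simp add: remove_copy_def)

lemma arcs_ends_remove_copy:
  "arcs_ends (remove_copy G p) =
     {(u, v) \<in> arcs_ends G. u \<notin> P3_verts p \<and> v \<notin> P3_verts p \<and> u \<in> verts G \<and> v \<in> verts G}"
  by (auto simp: arcs_ends_conv remove_copy_def)

lemma P3_copies_remove_copy:
  "P3_copies (remove_copy G p) = {q \<in> P3_copies G. P3_verts q \<inter> P3_verts p = {}}"
  unfolding P3_copies_def arcs_ends_remove_copy by auto

section \<open>Optimal play\<close>

lemma star_game_value_ge:
  assumes fin: "finite (verts G)" and ne: "copies_centred_at G v \<noteq> {}"
    and bound: "\<And>p. p \<in> copies_centred_at G v \<Longrightarrow>
      k \<le> Suc (star_game_value_min_responding (remove_copy G p))"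
  shows "k \<le> star_game_value_min_responding G"
proof -
  let ?worst = "\<lambda>v. Min ((\<lambda>p. Suc (star_game_value_min_responding (remove_copy G p)))
    ` copies_centred_at G v)"
  have fin': "finite (copies_centred_at G v)"
    using finite_P3_copies[OF fin] by (simp add: copies_centred_at_def)
  have v: "v \<in> verts G" and "P3_copies G \<noteq> {}"
    using ne by (auto simp: copies_centred_at_def P3_copies_def)
  then have "star_game_value_min_responding G =
      Max (?worst ` {v \<in> verts G. copies_centred_at G v \<noteq> {}})"
    using fin by (subst star_game_value_min_responding.simps) simp
  moreover have "k \<le> ?worst v"
    using fin' ne bound by (subst Min_ge_iff) auto
  moreover have "?worst v \<le> Max (?worst ` {v \<in> verts G. copies_centred_at G v \<noteq> {}})"
    using fin v ne by (intro Max_ge) auto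
  ultimately show ?thesis
    by linarith
qed

lemma star_game_value_le:
  assumes fin: "finite (verts G)"
    and answer: "\<And>v. copies_centred_at G v \<noteq> {} \<Longrightarrow>
      \<exists>p \<in> copies_centred_at G v. Suc (star_game_value_min_responding (remove_copy G p)) \<le> k"
  shows "star_game_value_min_responding G \<le> k"
proof (cases "P3_copies G = {}")
  case True
  then show ?thesis
    by (subst star_game_value_min_responding.simps) simp
next
  case False
  let ?worst = "\<lambda>v. Min ((\<lambda>p. Suc (star_game_value_min_responding (remove_copy G p)))
    ` copies_centred_at G v)"
  let ?V = "{v \<in> verts G. copies_centred_at G v \<noteq> {}}"
  have fin': "finite (copies_centred_at G v)" for v
    using finite_P3_copies[OF fin] by (simp add: copies_centred_at_def)
  have "?V \<noteq> {}"
    using False by (auto simp: copies_centred_at_def P3_copies_def)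
  moreover have "?worst v \<le> k" if v: "v \<in> ?V" for v
  proof -
    obtain p where "p \<in> copies_centred_at G v"
      "Suc (star_game_value_min_responding (remove_copy G p)) \<le> k"
      using answer v by blast
    then show ?thesis
      using fin' by (intro Min_le_iff[THEN iffD2]) auto
  qed
  ultimately have "Max (?worst ` ?V) \<le> k"
    using fin by (subst Max_le_iff) auto
  then show ?thesis
    using fin False by (subst star_game_value_min_responding.simps) simp
qed

section \<open>Forests and peripheral vertices\<close>

text \<open>Connectedness is lost when a copy is removed, so the lower bound is proved for forests.\<close>

definition undirected_forest :: "('a, 'b) pre_digraph \<Rightarrow> bool" where
  "undirected_forest G \<longleftrightarrow> graph G \<and> \<not> (\<exists>p. pre_digraph.cycle G p \<and> 3 \<le> length p)"

lemma undirected_forest_remove_copy: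
  assumes "undirected_forest G"
  shows "undirected_forest (remove_copy G p)"
proof -
  interpret graph G
    using assms by (simp add: undirected_forest_def)
  have ind: "induced_subgraph (remove_copy G p) G"
    unfolding remove_copy_def by (rule induced_induce) blast
  have "digraph (remove_copy G p)" "symmetric (remove_copy G p)"
    using digraphI_induced[OF ind] induced_graph_imp_symmetric[OF sym_arcs ind] by auto
  then have "graph (remove_copy G p)"
    by (rule digraph.graphI)
  moreover have "cycle q" if "pre_digraph.cycle (remove_copy G p) q" for q
    using subgraph_cycle[OF induced_imp_subgraph[OF ind] that] .
  ultimately show ?thesis
    using assms by (auto simp: undirected_forest_def)
qed

text \<open>
  A neighbour of the first vertex of a path that lies further along the path than the second
  vertex would close a cycle.
\<close>

lemma forest_extend_path:
  assumes "undirected_forest G" and path: "pre_digraph.apath G u p v"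
    and e: "e \<in> arcs G" "head G e = u" and new: "p \<noteq> [] \<Longrightarrow> tail G e \<noteq> head G (hd p)"
  shows "pre_digraph.apath G (tail G e) (e # p) v"
proof -
  interpret graph G
    using assms(1) by (simp add: undirected_forest_def)
  have walk: "awalk u p v" and dist: "distinct (awalk_verts u p)"
    using path by (auto simp: apath_def)
  have "tail G e \<notin> set (awalk_verts u p)"
  proof
    assume "tail G e \<in> set (awalk_verts u p)"
    from awalk_decomp[OF walk this] obtain q r where
      p: "p = q @ r" and q: "awalk u q (tail G e)" and r: "awalk (tail G e) r v"
      by blast
    have "q \<noteq> []"
      using q no_loops[OF e(1)] e(2) by (auto simp: awalk_Nil_iff)
    moreover have "q \<noteq> [b]" for b
      using q new p by (auto simp: awalk_simps)
    ultimately have "2 \<le> length q"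
      by (cases q rule: remdups_adj.cases) auto
    moreover have "distinct (awalk_verts u q)"
      using dist awalk_verts_append[OF walk[unfolded p]] by (simp add: p)
    then have "cycle (e # q)"
      using q e by (auto simp: cycle_def awalk_Cons_iff intro!: exI[of _ "tail G e"])
    ultimately have "cycle (e # q) \<and> 3 \<le> length (e # q)"
      by simp
    then show False
      using assms(1) by (auto simp: undirected_forest_def)
  qed
  then show ?thesis
    using path e by (auto simp: apath_Cons_iff)
qed

text \<open>
  Take the second vertex \<open>v\<close> of a longest path and its successor \<open>s\<close>.  Any other neighbour \<open>y\<close> of \<open>v\<close> may
  replace the first vertex of the path, and a further neighbour \<open>z\<close> of \<open>y\<close> would make that path longer.
\<close>

lemma forest_has_peripheral_centre:
  assumes "undirected_forest G" and ne: "P3_copies G \<noteq> {}"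
  obtains v s where "copies_centred_at G v \<noteq> {}"
    and "\<And>y z. y \<rightarrow>\<^bsub>G\<^esub> v \<Longrightarrow> y \<noteq> s \<Longrightarrow> z \<rightarrow>\<^bsub>G\<^esub> y \<Longrightarrow> z = v"
proof -
  interpret graph G
    using assms(1) by (simp add: undirected_forest_def)
  define is_path where "is_path = (\<lambda>p. \<exists>u v. apath u p v)"
  obtain a b c where abc: "a \<rightarrow>\<^bsub>G\<^esub> b" "b \<rightarrow>\<^bsub>G\<^esub> c" "a \<noteq> c" "a \<noteq> b" "b \<noteq> c"
    using ne by (auto simp: P3_copies_def)
  obtain e f where ef: "e \<in> arcs G" "tail G e = a" "head G e = b"
    "f \<in> arcs G" "tail G f = b" "head G f = c"
    using abc by (meson reachableE)
  have "apath a [e, f] c"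
    using ef abc by (auto simp: apath_simps)
  then have "is_path [e, f]"
    by (auto simp: is_path_def)
  moreover have "\<forall>p. is_path p \<longrightarrow> length p < card (verts G)"
    using length_apath_less by (auto simp: is_path_def)
  ultimately have "\<exists>p. is_path p \<and> (\<forall>q. is_path q \<longrightarrow> length q \<le> length p)"
    by (rule Lattices_Big.ex_has_greatest_nat)
  then obtain p where p: "is_path p" and longest: "\<And>q. is_path q \<Longrightarrow> length q \<le> length p"
    by blast
  have "length [e, f] \<le> length p"
    using longest \<open>is_path [e, f]\<close> by blast
  then obtain g h r where p_eq: "p = g # h # r"
    by (auto simp: Suc_le_length_iff numeral_2_eq_2)
  then obtain v where path: "apath (tail G g) (g # h # r) v"
    using p by (auto simp: is_path_def apath_Cons_iff)
  let ?v = "tail G h" and ?s = "head G h"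
  have gh: "g \<in> arcs G" "h \<in> arcs G" "head G g = ?v"
    and path': "apath ?v (h # r) v"
    using path by (auto simp: apath_Cons_iff)
  have distinct: "tail G g \<noteq> ?v" "tail G g \<noteq> ?s" "?v \<noteq> ?s"
    using path by (auto simp: apath_Cons_iff hd_in_awalk_verts awalkI_apath)
  have "(tail G g, ?v, ?s) \<in> copies_centred_at G ?v"
    using gh distinct in_arcs_imp_in_arcs_ends[OF gh(1)] in_arcs_imp_in_arcs_ends[OF gh(2)]
    by (auto simp: copies_centred_at_def P3_copies_def)
  moreover have "z = ?v" if y: "y \<rightarrow>\<^bsub>G\<^esub> ?v" "y \<noteq> ?s" and z: "z \<rightarrow>\<^bsub>G\<^esub> y" for y z
  proof (rule ccontr)
    assume "z \<noteq> ?v"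
    obtain k where k: "k \<in> arcs G" "tail G k = y" "head G k = ?v"
      using y(1) by (meson reachableE)
    obtain l where l: "l \<in> arcs G" "tail G l = z" "head G l = y"
      using z by (meson reachableE)
    have "apath y (k # h # r) v"
      using forest_extend_path[OF assms(1) path' k(1,3)] k y(2) by simp
    then have "apath z (l # k # h # r) v"
      using forest_extend_path[OF assms(1) _ l(1,3)] l k \<open>z \<noteq> ?v\<close> by simp
    then have "length (l # k # h # r) \<le> length p"
      using longest by (auto simp: is_path_def simp del: list.size)
    then show False
      by (simp add: p_eq)
  qed
  ultimately show ?thesis
    using that by blast
qed

text \<open>
  A packing member through a leaf attached to \<open>v\<close> also uses \<open>v\<close>, so the leaf in the removed copy
  causes no loss beyond the one already caused by \<open>v\<close>.
\<close>

lemma packing_number_remove_peripheral_copy: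
  assumes "graph G"
    and leaves: "\<And>y z. y \<rightarrow>\<^bsub>G\<^esub> v \<Longrightarrow> y \<noteq> s \<Longrightarrow> z \<rightarrow>\<^bsub>G\<^esub> y \<Longrightarrow> z = v"
    and p: "p \<in> copies_centred_at G v"
  shows "P3_packing_number G \<le> P3_packing_number (remove_copy G p) + 2"
proof -
  interpret graph G
    by fact
  obtain a b where p_eq: "p = (a, v, b)" and ab: "a \<rightarrow>\<^bsub>G\<^esub> v" "b \<rightarrow>\<^bsub>G\<^esub> v" "a \<noteq> b"
    using p graph_symmetric by (auto simp: copies_centred_at_def P3_copies_def)
  \<comment> \<open>Only one of the two ends can be the exceptional neighbour; \<open>l\<close> is the other one.\<close>
  obtain l c where lc: "P3_verts p = {l, v, c}" and l: "l \<rightarrow>\<^bsub>G\<^esub> v" "l \<noteq> s"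
    using ab p_eq by (cases "a = s") auto
  obtain P where P: "P3_packing G P" "card P = P3_packing_number G"
    using maximum_packing_exists[OF finite_verts] .
  have finP: "finite P"
    using finite_P3_packing[OF finite_verts P(1)] .
  let ?Q = "{q \<in> P. P3_verts q \<inter> P3_verts p = {}}"
  have leaf: "v \<in> P3_verts q" if q': "q \<in> P" "l \<in> P3_verts q" for q
  proof -
    obtain x y z where q: "q = (x, y, z)" "x \<rightarrow>\<^bsub>G\<^esub> y" "y \<rightarrow>\<^bsub>G\<^esub> z"
      using q'(1) P(1) by (auto simp: P3_packing_def P3_copies_def)
    have "y = v" if "l \<noteq> y"
      using q q'(2) that leaves[OF l] graph_symmetric by auto
    moreover have "x = v" if "l = y"
      using q that leaves[OF l] by auto
    ultimately show ?thesis
      using q by auto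
  qed
  have "P \<subseteq> ?Q \<union> ({q \<in> P. v \<in> P3_verts q} \<union> {q \<in> P. c \<in> P3_verts q})"
    using leaf lc by auto
  then have "card P \<le> card (?Q \<union> ({q \<in> P. v \<in> P3_verts q} \<union> {q \<in> P. c \<in> P3_verts q}))"
    using finP by (intro card_mono) auto
  also have "\<dots> \<le> card ?Q + (card {q \<in> P. v \<in> P3_verts q} + card {q \<in> P. c \<in> P3_verts q})"
    by (meson add_left_mono card_Un_le order_trans)
  also have "\<dots> \<le> card ?Q + 2"
    using card_packing_members_at_le_1[OF P(1), of v] card_packing_members_at_le_1[OF P(1), of c]
    by linarith
  also have "card ?Q \<le> P3_packing_number (remove_copy G p)"
    using P(1) by (intro card_le_packing_number) (auto simp: P3_packing_def P3_copies_remove_copy)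
  finally show ?thesis
    using P(2) by simp
qed

text \<open>The lower bound, free of rounding: \<open>\<lceil>m/2\<rceil> \<le> k\<close> is the same as \<open>m \<le> 2 k\<close>.\<close>

theorem forest_packing_number_le:
  assumes "undirected_forest G"
  shows "P3_packing_number G \<le> 2 * star_game_value_min_responding G"
  using assms
proof (induction "card (verts G)" arbitrary: G rule: less_induct)
  case less
  interpret graph G
    using less.prems by (simp add: undirected_forest_def)
  show ?case
  proof (cases "P3_copies G = {}")
    case True
    obtain P where "P3_packing G P" "card P = P3_packing_number G"
      using maximum_packing_exists[OF finite_verts] .
    then show ?thesis
      using True by (simp add: P3_packing_def)
  next
    case False
    obtain v s where ne: "copies_centred_at G v \<noteq> {}"
      and leaves: "\<And>y z. y \<rightarrow>\<^bsub>G\<^esub> v \<Longrightarrow> y \<noteq> s \<Longrightarrow> z \<rightarrow>\<^bsub>G\<^esub> y \<Longrightarrow> z = v"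
      using forest_has_peripheral_centre[OF less.prems False] by metis
    have "(P3_packing_number G + 1) div 2 \<le> Suc (star_game_value_min_responding (remove_copy G p))"
      if p: "p \<in> copies_centred_at G v" for p
    proof -
      have "p \<in> P3_copies G"
        using p by (simp add: copies_centred_at_def)
      then have "P3_packing_number (remove_copy G p)
          \<le> 2 * star_game_value_min_responding (remove_copy G p)"
        using less.hyps undirected_forest_remove_copy[OF less.prems] card_verts_remove_copy finite_verts
        by blast
      moreover have "P3_packing_number G \<le> P3_packing_number (remove_copy G p) + 2"
        using packing_number_remove_peripheral_copy[OF graph_axioms leaves p] .
      ultimately show ?thesis
        by linarith
    qed
    then have "(P3_packing_number G + 1) div 2 \<le> star_game_value_min_responding G"
      by (rule star_game_value_ge[OF finite_verts ne])
    then show ?thesis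
      by linarith
  qed
qed

section \<open>Caterpillars with two leaves at every spine vertex\<close>

text \<open>
  The \<open>j\<close>-th spine vertex is \<open>3 * j\<close>, and its two leaves are \<open>3 * j + 1\<close> and \<open>3 * j + 2\<close>.  The tree is
  rooted at 0; the formula sends both leaves to their spine vertex and \<open>3 * j\<close> to \<open>3 * (j - 1)\<close>.
\<close>

definition caterpillar_parent :: "nat \<Rightarrow> nat" where
  "caterpillar_parent n = 3 * ((n - 1) div 3)"

definition caterpillar_edge :: "nat \<Rightarrow> nat \<Rightarrow> nat \<Rightarrow> bool" where
  "caterpillar_edge m u v \<longleftrightarrow> u < 3 * m \<and> v < 3 * m \<and>
     (0 < u \<and> v = caterpillar_parent u \<or> 0 < v \<and> u = caterpillar_parent v)"

definition caterpillar :: "nat \<Rightarrow> (nat, nat \<times> nat) pre_digraph" where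
  "caterpillar m = \<lparr>verts = {..<3 * m}, arcs = {(u, v). caterpillar_edge m u v},
     tail = fst, head = snd\<rparr>"

lemma caterpillar_simps [simp]:
  "verts (caterpillar m) = {..<3 * m}"
  "arcs (caterpillar m) = {(u, v). caterpillar_edge m u v}"
  "tail (caterpillar m) = fst" "head (caterpillar m) = snd"
  by (simp_all add: caterpillar_def)

lemma dominates_caterpillar [simp]: "u \<rightarrow>\<^bsub>caterpillar m\<^esub> v \<longleftrightarrow> caterpillar_edge m u v"
  by (auto simp: arcs_ends_conv image_iff)

lemma caterpillar_parent_less: "0 < n \<Longrightarrow> caterpillar_parent n < n"
  using times_div_less_eq_dividend[of 3 "n - 1"] by (simp add: caterpillar_parent_def)

lemma caterpillar_edge_sym: "caterpillar_edge m u v \<Longrightarrow> caterpillar_edge m v u"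
  by (auto simp: caterpillar_edge_def)

lemma caterpillar_edge_less: "caterpillar_edge m u v \<Longrightarrow> v \<le> u \<Longrightarrow> v = caterpillar_parent u"
  using caterpillar_parent_less[of v] by (auto simp: caterpillar_edge_def)

lemma caterpillar_edge_irrefl: "\<not> caterpillar_edge m u u"
  using caterpillar_parent_less[of u] by (auto simp: caterpillar_edge_def)

lemma graph_caterpillar: "graph (caterpillar m)"
proof -
  have "{(u, v). caterpillar_edge m u v} \<subseteq> {..<3 * m} \<times> {..<3 * m}"
    by (auto simp: caterpillar_edge_def)
  then have "finite {(u, v). caterpillar_edge m u v}"
    by (rule finite_subset) simp
  then have "digraph (caterpillar m)"
    using caterpillar_edge_irrefl[of m]
    by unfold_locales (auto simp: arc_to_ends_def prod_eq_iff, auto simp: caterpillar_edge_def)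
  moreover have "symmetric (caterpillar m)"
    by (auto simp: symmetric_def sym_def caterpillar_edge_sym)
  ultimately show ?thesis
    by (rule digraph.graphI)
qed

text \<open>
  The largest vertex of a cycle of length at least 3 has two distinct smaller neighbours.
\<close>

lemma no_long_cycle_if_unique_smaller_neighbour:
  fixes G :: "('a :: linorder, 'b) pre_digraph"
  assumes "wf_digraph G"
    and unique: "\<And>n a b. n \<rightarrow>\<^bsub>G\<^esub> a \<Longrightarrow> b \<rightarrow>\<^bsub>G\<^esub> n \<Longrightarrow> a \<le> n \<Longrightarrow> b \<le> n \<Longrightarrow> a = b"
  shows "\<not> (\<exists>p. pre_digraph.cycle G p \<and> 3 \<le> length p)"
proof
  interpret wf_digraph G
    by fact
  assume "\<exists>p. cycle p \<and> 3 \<le> length p"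
  then obtain u p where walk: "awalk u p u" and dist: "distinct (tl (awalk_verts u p))"
    and len: "3 \<le> length p"
    by (auto simp: cycle_def)
  define n where "n = Max (set (awalk_verts u p))"
  have n: "n \<in> set (awalk_verts u p)"
    unfolding n_def by (rule Max_in) auto
  have le_n: "x \<le> n" if "x \<in> set (awalk_verts u p)" for x
    unfolding n_def using that by simp
  obtain q r where p: "p = q @ r" and q: "awalk u q n" and r: "awalk n r u"
    using awalk_decomp[OF walk n] by blast
  \<comment> \<open>Rotate the cycle so that it starts and ends in its largest vertex.\<close>
  have w: "awalk n (r @ q) n"
    using awalk_appendI[OF r q] .
  have "tl (awalk_verts u p) = tl (awalk_verts u q) @ tl (awalk_verts n r)"
    using awalk_verts_append[OF walk[unfolded p]] awlast_of_awalk[OF q] by (simp add: p)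
  moreover have "tl (awalk_verts n (r @ q)) = tl (awalk_verts n r) @ tl (awalk_verts u q)"
    using awalk_verts_append[OF w] awlast_of_awalk[OF r] by simp
  ultimately have dist': "distinct (tl (awalk_verts n (r @ q)))"
    using dist by auto
  have "3 \<le> length (r @ q)"
    using len p by simp
  then obtain e t where et: "r @ q = e # t" and "2 \<le> length t"
    by (cases "r @ q") auto
  then obtain mid f where tf: "t = mid @ [f]" and mid: "mid \<noteq> []"
    by (cases t rule: rev_cases) force+
  have walk_t: "awalk (head G e) (mid @ [f]) n"
    and e: "e \<in> arcs G" "tail G e = n"
    using w unfolding et tf by (auto simp: awalk_Cons_iff simp del: awalk_append_iff)
  then have walk_mid: "awalk (head G e) mid (tail G f)"
    and f: "f \<in> arcs G" "head G f = n"
    by (auto simp: awalk_simps)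
  have "distinct (awalk_verts (head G e) (mid @ [f]))"
    using dist' unfolding et tf by simp
  then have "apath (head G e) mid (tail G f)"
    using walk_mid awalk_verts_append[OF walk_t] by (simp add: apath_def)
  then have "head G e \<noteq> tail G f"
    using mid by (rule apath_nonempty_ends)
  moreover have "set (r @ q) = set p"
    using p by auto
  then have "e \<in> set p" "f \<in> set p"
    unfolding et tf by auto
  then have "head G e \<le> n" "tail G f \<le> n"
    using le_n awalk_verts_arc1 awalk_verts_arc2[OF walk] by blast+
  ultimately show False
    using unique[of n "head G e" "tail G f"] e f
      in_arcs_imp_in_arcs_ends[OF e(1)] in_arcs_imp_in_arcs_ends[OF f(1)] by simp
qed

lemma undirected_tree_caterpillar:
  assumes "0 < m"
  shows "undirected_tree (caterpillar m)"
proof -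
  interpret graph "caterpillar m"
    by (rule graph_caterpillar)
  have acyclic: "\<not> (\<exists>p. cycle p \<and> 3 \<le> length p)"
    by (rule no_long_cycle_if_unique_smaller_neighbour[OF wf_digraph_axioms])
      (metis dominates_caterpillar caterpillar_edge_less caterpillar_edge_sym)
  have root: "v \<rightarrow>\<^sup>*\<^bsub>caterpillar m\<^esub> 0" if "v < 3 * m" for v
    using that
  proof (induction v rule: less_induct)
    case (less v)
    show ?case
    proof (cases "v = 0")
      case False
      then have "v \<rightarrow>\<^bsub>caterpillar m\<^esub> caterpillar_parent v"
        using less.prems caterpillar_parent_less[of v] by (simp add: caterpillar_edge_def)
      moreover have "caterpillar_parent v \<rightarrow>\<^sup>*\<^bsub>caterpillar m\<^esub> 0"
        using less False caterpillar_parent_less[of v] by simp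
      ultimately show ?thesis
        by (rule adj_reachable_trans)
    qed (use less.prems in simp)
  qed
  have "u \<rightarrow>\<^sup>*\<^bsub>caterpillar m\<^esub> v" if "u < 3 * m" "v < 3 * m" for u v
    using reachable_trans[OF root[OF that(1)] symmetric_reachable'[OF root[OF that(2)]]] .
  moreover have "0 \<in> {..<3 * m}"
    using assms by simp
  then have "{..<3 * m} \<noteq> {}"
    by blast
  ultimately have "Digraph_Component.connected (caterpillar m)"
    by (auto simp: Digraph_Component.connected_def strongly_connected_def
        reachable_mk_symmetric_eq[OF sym_arcs])
  then show ?thesis
    using graph_caterpillar acyclic by (simp add: undirected_tree_def)
qed

lemma caterpillar_star_edges:
  assumes "j < m"
  shows "caterpillar_edge m (3 * j + 1) (3 * j)" "caterpillar_edge m (3 * j) (3 * j + 2)"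
  using assms by (auto simp: caterpillar_edge_def caterpillar_parent_def)

lemma caterpillar_spine_edge:
  assumes "Suc j < m"
  shows "caterpillar_edge m (3 * j) (3 * Suc j)"
  using assms by (auto simp: caterpillar_edge_def caterpillar_parent_def)

text \<open>The \<open>m\<close> stars around the spine vertices use up all \<open>3 * m\<close> vertices.\<close>

lemma packing_number_caterpillar: "P3_packing_number (caterpillar m) = m"
proof (rule antisym)
  let ?P = "(\<lambda>j. (3 * j + 1, 3 * j, 3 * j + 2)) ` {..<m}"
  have "P3_packing (caterpillar m) ?P"
    using caterpillar_star_edges
    by (auto simp: P3_packing_def P3_copies_def)
  then have "card ?P \<le> P3_packing_number (caterpillar m)"
    by (intro card_le_packing_number) simp
  then show "m \<le> P3_packing_number (caterpillar m)"
    by (subst (asm) card_image) (auto simp: inj_on_def)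
  obtain P where P: "P3_packing (caterpillar m) P" "card P = P3_packing_number (caterpillar m)"
    using maximum_packing_exists[of "caterpillar m"] by auto
  have fin: "finite P"
    using finite_P3_packing[OF _ P(1)] by simp
  have "card (P3_verts q) = 3" if "q \<in> P" for q
    using that P(1) by (auto simp: P3_packing_def P3_copies_def)
  then have "card (\<Union> (P3_verts ` P)) = 3 * card P"
    using P(1) fin by (subst card_UN_disjoint) (auto simp: P3_packing_def)
  moreover have "\<Union> (P3_verts ` P) \<subseteq> {..<3 * m}"
    using P(1) P3_verts_subset by (fastforce simp: P3_packing_def)
  then have "card (\<Union> (P3_verts ` P)) \<le> 3 * m"
    by (metis card_lessThan card_mono finite_lessThan)
  ultimately show "P3_packing_number (caterpillar m) \<le> m"
    using P(2) by simp
qed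

text \<open>The only neighbour of a leaf is its parent.\<close>

lemma caterpillar_centre_on_spine:
  assumes "(u, v, w) \<in> P3_copies (caterpillar m)"
  shows "3 dvd v"
proof (rule ccontr)
  assume "\<not> 3 dvd v"
  then have "x = caterpillar_parent v" if "caterpillar_edge m v x" for x
    using that by (auto simp: caterpillar_edge_def caterpillar_parent_def)
  moreover have "caterpillar_edge m v u" "caterpillar_edge m v w"
    using assms caterpillar_edge_sym by (auto simp: P3_copies_def)
  ultimately have "u = w"
    by metis
  then show False
    using assms by (simp add: P3_copies_def)
qed

text \<open>
  A position that is reachable under the pairing strategy is described by its vertex set alone.  The
  potential is the number of pairs \<open>{2 * i, 2 * i + 1}\<close> of spine indices with a surviving member.
\<close>

lemma caterpillar_position_value_le:
  assumes "verts G \<subseteq> {..<3 * m}"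
    and "P3_copies G = {q \<in> P3_copies (caterpillar m). P3_verts q \<subseteq> verts G}"
    and "\<And>j. 3 * j \<in> verts G \<Longrightarrow> 3 * j + 1 \<in> verts G \<and> 3 * j + 2 \<in> verts G"
  shows "star_game_value_min_responding G \<le> card {j div 2 |j. 3 * j \<in> verts G}"
  using assms
proof (induction "card (verts G)" arbitrary: G rule: less_induct)
  case less
  note sub = less.prems(1) and copies = less.prems(2) and leaves = less.prems(3)
  have fin: "finite (verts G)"
    using sub finite_subset by blast
  let ?pairs = "\<lambda>V. {j div 2 |j. 3 * j \<in> V}"
  have "?pairs (verts G) \<subseteq> (\<lambda>n. n div 3 div 2) ` verts G"
    by force
  then have fin_pairs: "finite (?pairs (verts G))"
    using fin by (meson finite_imageI finite_subset)
  show ?case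
  proof (rule star_game_value_le[OF fin])
    fix v
    assume "copies_centred_at G v \<noteq> {}"
    then obtain a b where abc: "(a, v, b) \<in> P3_copies G"
      by (auto simp: copies_centred_at_def)
    then have "(a, v, b) \<in> P3_copies (caterpillar m)"
      using copies by simp
    then have "3 dvd v"
      by (rule caterpillar_centre_on_spine)
    moreover have "v \<in> verts G"
      using P3_verts_subset[OF abc] by simp
    ultimately obtain j where v: "v = 3 * j" and j: "3 * j \<in> verts G" and "j < m"
      using sub by (auto simp: dvd_def)
    \<comment> \<open>The partner of \<open>j\<close> in the pair \<open>{2 * i, 2 * i + 1}\<close>.\<close>
    define j' where "j' = (if even j then Suc j else j - 1)"
    have j': "j' div 2 = j div 2" "j' \<noteq> j" "\<And>i. i div 2 = j div 2 \<Longrightarrow> i = j \<or> i = j'"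
      unfolding j'_def by (auto elim!: evenE oddE)
    define p where "p = (3 * j + 1, 3 * j, if 3 * j' \<in> verts G then 3 * j' else 3 * j + 2)"
    have "caterpillar_edge m (3 * j) (3 * j')" if "3 * j' \<in> verts G"
    proof (cases "even j")
      case True
      then show ?thesis
        using that sub caterpillar_spine_edge[of j m] by (auto simp: j'_def)
    next
      case False
      then show ?thesis
        using \<open>j < m\<close> caterpillar_spine_edge[of "j - 1" m] caterpillar_edge_sym
        by (auto simp: j'_def elim!: oddE)
    qed
    moreover have "3 * j' \<noteq> 3 * j + 1"
      by presburger
    ultimately have "p \<in> P3_copies (caterpillar m)" and "P3_verts p \<subseteq> verts G"
      using caterpillar_star_edges[OF \<open>j < m\<close>] j leaves[OF j] sub j'(2)
      by (auto simp: p_def P3_copies_def)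
    then have p: "p \<in> P3_copies G"
      using copies by simp
    let ?G = "remove_copy G p"
    have spine: "3 * i \<in> verts ?G \<longleftrightarrow> 3 * i \<in> verts G \<and> i \<noteq> j \<and> i \<noteq> j'" for i
      by (auto simp: p_def)
    have "star_game_value_min_responding ?G \<le> card (?pairs (verts ?G))"
    proof (rule less.hyps)
      show "card (verts ?G) < card (verts G)"
        using card_verts_remove_copy[OF fin p] .
      show "verts ?G \<subseteq> {..<3 * m}"
        using sub by auto
      show "P3_copies ?G = {q \<in> P3_copies (caterpillar m). P3_verts q \<subseteq> verts ?G}"
        unfolding P3_copies_remove_copy copies by auto
      show "3 * i + 1 \<in> verts ?G \<and> 3 * i + 2 \<in> verts ?G" if "3 * i \<in> verts ?G" for i
        using that leaves[of i] unfolding spine by (auto simp: p_def)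
    qed
    also have "\<dots> < card (?pairs (verts G))"
    proof (rule psubset_card_mono[OF fin_pairs])
      have "x \<in> ?pairs (verts G) \<and> x \<noteq> j div 2" if "x \<in> ?pairs (verts ?G)" for x
      proof -
        obtain i where "x = i div 2" "3 * i \<in> verts ?G"
          using \<open>x \<in> ?pairs (verts ?G)\<close> by auto
        then show ?thesis
          using spine[of i] j'(3)[of i] by auto
      qed
      moreover have "j div 2 \<in> ?pairs (verts G)"
        using j by auto
      ultimately show "?pairs (verts ?G) \<subset> ?pairs (verts G)"
        by blast
    qed
    finally have "Suc (star_game_value_min_responding ?G) \<le> card (?pairs (verts G))"
      by simp
    moreover have "p \<in> copies_centred_at G v"
      using p by (simp add: copies_centred_at_def p_def v)
    ultimately show "\<exists>p \<in> copies_centred_at G v.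
        Suc (star_game_value_min_responding (remove_copy G p)) \<le> card (?pairs (verts G))"
      by blast
  qed
qed

lemma caterpillar_value_le: "star_game_value_min_responding (caterpillar m) \<le> (m + 1) div 2"
proof -
  have "P3_copies (caterpillar m)
      = {q \<in> P3_copies (caterpillar m). P3_verts q \<subseteq> verts (caterpillar m)}"
    using P3_verts_subset by blast
  then have "star_game_value_min_responding (caterpillar m)
      \<le> card {j div 2 |j. 3 * j \<in> verts (caterpillar m)}"
    by (intro caterpillar_position_value_le) auto
  also have "\<dots> \<le> card {..<(m + 1) div 2}"
    by (intro card_mono) auto
  finally show ?thesis
    by simp
qed

section \<open>The value of the star-game on trees\<close>

lemma ceiling_half: "\<lceil>real m / 2\<rceil> = int ((m + 1) div 2)"
  by (cases "even m") (auto elim!: evenE oddE simp: ceiling_eq_iff)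

theorem lemma6:
  shows "(\<forall>(T :: ('a, 'b) pre_digraph) (m :: nat).
            undirected_tree T \<and> P3_packing_number T = m \<longrightarrow>
            \<lceil>real m / 2\<rceil> \<le> int (star_game_value_min_responding T)) \<and>
         (\<forall>m :: nat. m > 0 \<longrightarrow>
            (\<exists>T :: (nat, nat \<times> nat) pre_digraph.
               undirected_tree T \<and> P3_packing_number T = m \<and>
               int (star_game_value_min_responding T) = \<lceil>real m / 2\<rceil>))"
proof (intro conjI allI impI)
  fix T :: "('a, 'b) pre_digraph" and m :: nat
  assume T: "undirected_tree T \<and> P3_packing_number T = m"
  then have "undirected_forest T"
    by (simp add: undirected_tree_def undirected_forest_def)
  then have "m \<le> 2 * star_game_value_min_responding T"
    using forest_packing_number_le T by blast
  then show "\<lceil>real m / 2\<rceil> \<le> int (star_game_value_min_responding T)"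
    unfolding ceiling_half by linarith
next
  fix m :: nat
  assume "m > 0"
  then have tree: "undirected_tree (caterpillar m)"
    by (rule undirected_tree_caterpillar)
  then have "undirected_forest (caterpillar m)"
    by (simp add: undirected_tree_def undirected_forest_def)
  then have "m \<le> 2 * star_game_value_min_responding (caterpillar m)"
    using forest_packing_number_le packing_number_caterpillar by metis
  then have "int (star_game_value_min_responding (caterpillar m)) = \<lceil>real m / 2\<rceil>"
    unfolding ceiling_half using caterpillar_value_le[of m] by linarith
  then show "\<exists>T :: (nat, nat \<times> nat) pre_digraph.
      undirected_tree T \<and> P3_packing_number T = m \<and>
      int (star_game_value_min_responding T) = \<lceil>real m / 2\<rceil>"
    using tree packing_number_caterpillar by blast
qed

end
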